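(* Let $M_1$ and $M_2$ be strongly base reorderable loopless matroids on the same ground set $E$. Then $\beta(M_1\cap M_2)=\max\{\beta(M_1),\beta(M_2)\}$.
   Context: A matroid is strongly base reorderable if for any pair $A,B$ of bases there exist bases $A',B'$ and a bijection $\varphi\colon A'\setminus B'\to B'\setminus A'$ such that $A'\cap B'=A\cap B$, $A'\cup B'=A\cup B$, and $(A'\setminus X)\cup\varphi(X)$ is a basis for every $X\subseteq A'\setminus B'$. For a loopless matroid $M$, the covering number $\beta(M)$ is the minimum number of independent sets of $M$ needed to cover its ground set. For matroids $M_1,M_2$ on the same ground set, $\beta(M_1\cap M_2)$ is the minimum number of sets independent in both $M_1$ and $M_2$ needed to cover the ground set. *)

theory Defs
  imports Main
begin

locale matroid =
  fixes E :: "'a set" and indep :: "'a set \<Rightarrow> bool"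
  assumes finite_ground: "finite E"
    and indep_subset_ground: "indep X \<Longrightarrow> X \<subseteq> E"
    and indep_empty: "indep {}"
    and indep_subset: "indep X \<Longrightarrow> Y \<subseteq> X \<Longrightarrow> indep Y"
    and augment: "indep X \<Longrightarrow> indep Y \<Longrightarrow> card X < card Y \<Longrightarrow> \<exists>y \<in> Y - X. indep (insert y X)"

definition loopless :: "'a set \<Rightarrow> ('a set \<Rightarrow> bool) \<Rightarrow> bool" where
  "loopless E indep \<longleftrightarrow> (\<forall>e \<in> E. indep {e})"

definition basis :: "('a set \<Rightarrow> bool) \<Rightarrow> 'a set \<Rightarrow> bool" where
  "basis indep B \<longleftrightarrow> indep B \<and> (\<forall>X. indep X \<longrightarrow> B \<subseteq> X \<longrightarrow> X = B)"

definition strongly_base_reorderable :: "('a set \<Rightarrow> bool) \<Rightarrow> bool" where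
  "strongly_base_reorderable indep \<longleftrightarrow>
    (\<forall>A B. basis indep A \<longrightarrow> basis indep B \<longrightarrow>
      (\<exists>A' B' \<phi>. basis indep A' \<and> basis indep B' \<and>
        bij_betw \<phi> (A' - B') (B' - A') \<and>
        A' \<inter> B' = A \<inter> B \<and> A' \<union> B' = A \<union> B \<and>
        (\<forall>X \<subseteq> A' - B'. basis indep ((A' - X) \<union> \<phi> ` X))))"

text \<open>
  The family \<open>P\<close> of admissible sets is a parameter, so that the same notion covers a single
  matroid and the common independent sets of two matroids. \<open>LEAST\<close> is unspecified when no finite
  cover exists; the lemma below rules this out in the loopless case.
\<close>

definition covering_number :: "'a set \<Rightarrow> ('a set \<Rightarrow> bool) \<Rightarrow> nat" where
  "covering_number E P =
    (LEAST k. \<exists>F. finite F \<and> card F = k \<and> (\<forall>X \<in> F. P X) \<and> E \<subseteq> \<Union>F)"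

lemma covering_number_attained:
  assumes "finite E" and "\<forall>e \<in> E. P {e}"
  shows "\<exists>F. finite F \<and> card F = covering_number E P \<and> (\<forall>X \<in> F. P X) \<and> E \<subseteq> \<Union>F"
proof -
  let ?F = "(\<lambda>e. {e}) ` E"
  have "finite ?F \<and> card ?F = card ?F \<and> (\<forall>X \<in> ?F. P X) \<and> E \<subseteq> \<Union>?F"
    using assms by auto
  then have "\<exists>k F. finite F \<and> card F = k \<and> (\<forall>X \<in> F. P X) \<and> E \<subseteq> \<Union>F" by blast
  then show ?thesis unfolding covering_number_def by (rule LeastI_ex)
qed

end

theory Submission
  imports Defs
begin

text \<open>
  Following Davies and McDiarmid: let \<open>k\<close> be the larger covering number, and choose a partition of
  \<open>E\<close> into \<open>k\<close> classes independent in \<open>M\<^sub>1\<close> and one into \<open>k\<close> classes independent in \<open>M\<^sub>2\<close>, such that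
  the number of elements with the same class index in both is maximal. Suppose that an element has
  indices \<open>i \<noteq> j\<close>. Strong base reorderability gives a matching on the union of the classes \<open>i\<close> and
  \<open>j\<close> of \<open>M\<^sub>1\<close> such that every subset containing no matched pair is independent, and similarly for
  \<open>M\<^sub>2\<close>. The union of two matchings is bipartite, and redistributing the classes \<open>i\<close> and \<open>j\<close> in both
  partitions according to a common 2-colouring increases the agreement. So the two optimal
  partitions coincide.
\<close>

text \<open>
  The matched pair \<open>(u, \<phi> u)\<close> is removed and its at most two neighbours under the other matching
  \<open>N\<close> are joined instead, which keeps \<open>N\<close> a matching.
\<close>

lemma two_matchings_colouring:
  fixes \<phi> :: "'a \<Rightarrow> 'a" and N :: "('a \<times> 'a) set"
  assumes "finite X" "inj_on \<phi> X" "\<phi> ` X \<inter> X = {}" "sym N" "irrefl N" "single_valued N"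
  shows "\<exists>c :: 'a \<Rightarrow> bool. (\<forall>x\<in>X. c x \<noteq> c (\<phi> x)) \<and> (\<forall>x y. (x, y) \<in> N \<longrightarrow> c x \<noteq> c y)"
  using assms
proof (induction X arbitrary: N rule: finite_induct)
  case empty
  \<comment> \<open>Only \<open>N\<close> is left to separate. The choice depends on the unordered
    pair alone, so it selects exactly one end of each edge; points that \<open>N\<close> does not
    meet become \<open>False\<close>.\<close>
  define c where "c x \<longleftrightarrow> (\<exists>y. (x, y) \<in> N \<and> (SOME z. z \<in> {x, y}) = x)" for x
  have "c x \<noteq> c y" if "(x, y) \<in> N" for x y
  proof -
    have yx: "(y, x) \<in> N" using that empty.prems(3) by (auto dest: symD)
    have "x \<noteq> y" using that empty.prems(4) by (auto simp: irrefl_def)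
    have "(x, z) \<in> N \<longleftrightarrow> z = y" "(y, z) \<in> N \<longleftrightarrow> z = x" for z
      using that yx empty.prems(5) by (auto dest: single_valuedD)
    then have "c x \<longleftrightarrow> (SOME z. z \<in> {x, y}) = x" "c y \<longleftrightarrow> (SOME z. z \<in> {y, x}) = y"
      unfolding c_def by simp_all
    moreover have "{y, x} = {x, y}" by auto
    moreover have "(SOME z. z \<in> {x, y}) \<in> {x, y}"
      by (rule someI[of _ x]) simp
    ultimately show ?thesis using \<open>x \<noteq> y\<close> by (metis insertE singletonD)
  qed
  then show ?case by auto
next
  case (insert u X)
  define v where "v = \<phi> u"
  have uv: "u \<noteq> v" "v \<notin> X" using insert.prems(2) by (auto simp: v_def)
  \<comment> \<open>The remaining matched pairs avoid \<open>u\<close> and \<open>v\<close>, so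
    these two can be coloured last without spoiling them.\<close>
  have \<phi>X: "\<phi> x \<noteq> u" "\<phi> x \<noteq> v" if "x \<in> X" for x
    using that insert.prems(1,2) insert.hyps(2) by (auto simp: v_def image_iff)
  have sy: "(x, y) \<in> N \<Longrightarrow> (y, x) \<in> N" for x y
    using insert.prems(3) by (auto dest: symD)
  have irr: "(x, x) \<notin> N" for x
    using insert.prems(4) by (auto simp: irrefl_def)
  have sv: "(x, y) \<in> N \<Longrightarrow> (x, z) \<in> N \<Longrightarrow> y = z" for x y z
    using insert.prems(5) by (auto dest: single_valuedD)
  \<comment> \<open>A path x, u, v, y forces different colours on its ends, and the new edge records
    this. It is no loop, since a point with both \<open>u\<close> and \<open>v\<close> as
    \<open>N\<close>-neighbours would give \<open>u = v\<close>. The last disjunct keeps the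
    relation symmetric.\<close>
  define N' where "N' = {(x, y). x \<notin> {u, v} \<and> y \<notin> {u, v} \<and>
    ((x, y) \<in> N \<or> (x, u) \<in> N \<and> (v, y) \<in> N \<or> (x, v) \<in> N \<and> (u, y) \<in> N)}"
  have "sym N'" unfolding sym_def N'_def using sy by blast
  moreover have "irrefl N'" unfolding irrefl_def N'_def using sy irr sv uv by (clarsimp, metis)
  moreover have "single_valued N'"
    unfolding single_valued_def N'_def using sv uv sy by (clarsimp, metis)
  moreover have "inj_on \<phi> X" "\<phi> ` X \<inter> X = {}" using insert.prems(1,2) by auto
  ultimately have "\<exists>c :: 'a \<Rightarrow> bool. (\<forall>x\<in>X. c x \<noteq> c (\<phi> x)) \<and> (\<forall>x y. (x, y) \<in> N' \<longrightarrow> c x \<noteq> c y)"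
    by (intro insert.IH)
  then obtain c :: "'a \<Rightarrow> bool" where
    c: "\<forall>x\<in>X. c x \<noteq> c (\<phi> x)" "\<And>x y. (x, y) \<in> N' \<Longrightarrow> c x \<noteq> c y"
    by (elim exE conjE) (rule that, assumption, blast)
  \<comment> \<open>The colour for \<open>u\<close>; \<open>v\<close> gets the opposite one. So
    \<open>p\<close> must differ from the colour of the outer \<open>N\<close>-neighbour of
    \<open>u\<close> and equal that of the outer \<open>N\<close>-neighbour of \<open>v\<close>. If
    both exist, \<open>N'\<close> joins them, so their colours differ and the two demands agree; if
    neither exists, \<open>p\<close> is \<open>False\<close>.\<close>
  define p where "p \<longleftrightarrow> (\<exists>x. x \<notin> {u, v} \<and> ((u, x) \<in> N \<and> \<not> c x \<or> (v, x) \<in> N \<and> c x))"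
  have pu: "p \<noteq> c x" if "(u, x) \<in> N" "x \<notin> {u, v}" for x
  proof (cases "c x")
    case True
    have "\<not> c y" if "(v, y) \<in> N" "y \<notin> {u, v}" for y
      using c(2)[of x y] that \<open>(u, x) \<in> N\<close> \<open>x \<notin> {u, v}\<close> sy[OF \<open>(u, x) \<in> N\<close>] True by (auto simp: N'_def)
    moreover have "y = x" if "(u, y) \<in> N" for y
      using that \<open>(u, x) \<in> N\<close> sv by blast
    ultimately show ?thesis using True unfolding p_def by blast
  qed (use that in \<open>auto simp: p_def\<close>)
  have pv: "p = c x" if "(v, x) \<in> N" "x \<notin> {u, v}" for x
  proof (cases "c x")
    case False
    have "c y" if "(u, y) \<in> N" "y \<notin> {u, v}" for y
      using c(2)[of y x] that \<open>(v, x) \<in> N\<close> \<open>x \<notin> {u, v}\<close> sy[OF that(1)] False by (auto simp: N'_def)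
    moreover have "y = x" if "(v, y) \<in> N" for y
      using that \<open>(v, x) \<in> N\<close> sv by blast
    ultimately show ?thesis using False unfolding p_def by blast
  qed (use that in \<open>auto simp: p_def\<close>)
  define d where "d = c(u := p, v := \<not> p)"
  have d_simps: "d u = p" "d v = (\<not> p)" "\<And>x. x \<noteq> u \<Longrightarrow> x \<noteq> v \<Longrightarrow> d x = c x"
    using uv by (auto simp: d_def)
  have "d x \<noteq> d (\<phi> x)" if "x \<in> insert u X" for x
  proof (cases "x = u")
    case True
    then show ?thesis using d_simps by (simp add: v_def)
  next
    case False
    then have "x \<in> X" "x \<noteq> v" using that uv by auto
    then show ?thesis using False c(1) \<phi>X[of x] d_simps(3) by auto
  qed
  moreover have "d x \<noteq> d y" if "(x, y) \<in> N" for x y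
  proof -
    have eq: "x \<noteq> y" using that irr by auto
    consider "x \<notin> {u, v}" "y \<notin> {u, v}" | "x \<in> {u, v}" "y \<in> {u, v}"
      | "x \<in> {u, v}" "y \<notin> {u, v}" | "x \<notin> {u, v}" "y \<in> {u, v}" by blast
    then show ?thesis
    proof cases
      case 1
      then show ?thesis using c(2)[of x y] that d_simps(3) by (auto simp: N'_def)
    next
      case 2
      then show ?thesis using eq d_simps by auto
    next
      case 3
      then show ?thesis using pu[of y] pv[of y] that d_simps by auto
    next
      case 4
      then show ?thesis using pu[of x] pv[of x] sy[OF that] d_simps by auto
    qed
  qed
  ultimately show ?case by blast
qed

lemma two_bijections_colouring:
  fixes \<phi> \<psi> :: "'a \<Rightarrow> 'a"
  assumes "finite X" "bij_betw \<phi> X Y" "X \<inter> Y = {}" "bij_betw \<psi> Z W" "Z \<inter> W = {}"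
  shows "\<exists>c :: 'a \<Rightarrow> bool. (\<forall>x\<in>X. c x \<noteq> c (\<phi> x)) \<and> (\<forall>z\<in>Z. c z \<noteq> c (\<psi> z))"
proof -
  \<comment> \<open>The second matching in relational form. Disjointness of \<open>Z\<close> and
    \<open>W\<close> excludes loops and, with injectivity of \<open>\<psi>\<close>, gives every
    point at most one partner.\<close>
  define N where "N = {(z, \<psi> z) |z. z \<in> Z} \<union> {(\<psi> z, z) |z. z \<in> Z}"
  have W: "\<psi> z \<in> W" "\<psi> z \<notin> Z" if "z \<in> Z" for z
    using that assms(4,5) by (auto simp: bij_betw_def)
  have "sym N" by (auto simp: N_def sym_def)
  moreover have "irrefl N" using W(2) by (force simp: N_def irrefl_def)
  moreover have "single_valued N"
    using W assms(4) by (auto simp: N_def single_valued_def bij_betw_def dest: inj_onD)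
  moreover have "inj_on \<phi> X" "\<phi> ` X \<inter> X = {}"
    using assms(2,3) by (auto simp: bij_betw_def)
  ultimately have "\<exists>c :: 'a \<Rightarrow> bool. (\<forall>x\<in>X. c x \<noteq> c (\<phi> x)) \<and> (\<forall>x y. (x, y) \<in> N \<longrightarrow> c x \<noteq> c y)"
    by (intro two_matchings_colouring assms(1))
  moreover have "(z, \<psi> z) \<in> N" if "z \<in> Z" for z
    using that by (auto simp: N_def)
  ultimately show ?thesis by (elim ex_forward) auto
qed

section \<open>Matchings from strong base reorderability\<close>

lemma (in matroid) extends_to_basis:
  assumes "indep X"
  shows "\<exists>B. basis indep B \<and> X \<subseteq> B"
proof -
  have fin: "finite {Y. indep Y \<and> X \<subseteq> Y}"
    by (rule finite_subset[of _ "Pow E"]) (auto simp: finite_ground dest: indep_subset_ground)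
  have "X \<in> {Y. indep Y \<and> X \<subseteq> Y}" using assms by simp
  from finite_has_maximal2[OF fin this] show ?thesis
    unfolding basis_def by (metis (mono_tags, lifting) mem_Collect_eq order_trans)
qed

text \<open>Extend \<open>I\<close> and \<open>J\<close> to bases and reorder these: the exchange
  bijection is the matching. A set without matched pairs fits into one of the exchanged bases. The
  matching may also involve elements outside \<open>I \<union> J\<close>.\<close>

lemma (in matroid) exchange_matching:
  assumes "strongly_base_reorderable indep" "indep I" "indep J"
  obtains X Y \<phi> where "finite X" "bij_betw \<phi> X Y" "X \<inter> Y = {}"
    "\<And>C. C \<subseteq> I \<union> J \<Longrightarrow> \<forall>x\<in>X. x \<notin> C \<or> \<phi> x \<notin> C \<Longrightarrow> indep C"
proof -
  obtain A B where AB: "basis indep A" "I \<subseteq> A" "basis indep B" "J \<subseteq> B"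
    using extends_to_basis assms(2,3) by blast
  then obtain A' B' \<phi> where 1: "basis indep A'" "bij_betw \<phi> (A' - B') (B' - A')"
    "A' \<union> B' = A \<union> B" "\<And>X. X \<subseteq> A' - B' \<Longrightarrow> basis indep ((A' - X) \<union> \<phi> ` X)"
    using assms(1) unfolding strongly_base_reorderable_def by metis
  have "indep C" if C: "C \<subseteq> I \<union> J" "\<forall>x\<in>A' - B'. x \<notin> C \<or> \<phi> x \<notin> C" for C
  proof (rule indep_subset)
    \<comment> \<open>Exchange exactly the elements whose partner lies in \<open>C\<close>. None of
      them is in \<open>C\<close> itself, so no element of \<open>C\<close> is removed, and each
      element of \<open>C\<close> in \<open>B' - A'\<close> is brought in.\<close>
    let ?X = "{x \<in> A' - B'. \<phi> x \<in> C}"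
    show "indep ((A' - ?X) \<union> \<phi> ` ?X)"
      using 1(4)[of ?X] by (auto simp: basis_def)
    show "C \<subseteq> (A' - ?X) \<union> \<phi> ` ?X"
    proof
      fix x assume x: "x \<in> C"
      then have "x \<in> A' \<union> B'" using C(1) AB(2,4) 1(3) by auto
      moreover have "x \<in> \<phi> ` (A' - B')" if "x \<in> B'" "x \<notin> A'"
        using that 1(2) by (auto simp: bij_betw_def)
      ultimately show "x \<in> (A' - ?X) \<union> \<phi> ` ?X" using x C(2) by auto
    qed
  qed
  moreover have "finite (A' - B')"
    using 1(1) finite_subset[OF indep_subset_ground finite_ground] by (simp add: basis_def)
  moreover have "(A' - B') \<inter> (B' - A') = {}" by auto
  ultimately show thesis using 1(2) that by metis
qed

section \<open>Partitions into independent classes\<close>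

definition partition_colouring :: "'a set \<Rightarrow> ('a set \<Rightarrow> bool) \<Rightarrow> nat \<Rightarrow> ('a \<Rightarrow> nat) \<Rightarrow> bool" where
  "partition_colouring E P k f \<longleftrightarrow> (\<forall>e\<in>E. f e < k) \<and> (\<forall>i. P {e \<in> E. f e = i})"

lemma covering_number_le:
  assumes "partition_colouring E P k f" "finite E"
  shows "covering_number E P \<le> k"
proof -
  let ?F = "(\<lambda>i. {e \<in> E. f e = i}) ` {..<k}"
  have "finite ?F \<and> card ?F = card ?F \<and> (\<forall>X\<in>?F. P X) \<and> E \<subseteq> \<Union>?F"
    using assms(1) by (auto simp: partition_colouring_def)
  then have "covering_number E P \<le> card ?F"
    unfolding covering_number_def by (intro Least_le) blast
  also have "\<dots> \<le> k" using card_image_le[of "{..<k}"] by simp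
  finally show ?thesis .
qed

lemma (in matroid) partition_colouring_exists:
  assumes "loopless E indep" "covering_number E indep \<le> k"
  shows "\<exists>f. partition_colouring E indep k f"
proof -
  obtain F where F: "finite F" "card F = covering_number E indep" "\<forall>X\<in>F. indep X" "E \<subseteq> \<Union>F"
    using covering_number_attained[OF finite_ground] assms(1) unfolding loopless_def by metis
  obtain h where h: "bij_betw h F {0..<card F}"
    using ex_bij_betw_finite_nat[OF F(1)] by blast
  \<comment> \<open>The members of a cover may overlap, so \<open>g\<close> assigns each element to
    one of them and \<open>h\<close> numbers them. Each class then lies inside a member of the cover
    and is independent by heredity.\<close>
  have "\<forall>e\<in>E. \<exists>X. X \<in> F \<and> e \<in> X" using F(4) by blast
  then obtain g where g: "\<And>e. e \<in> E \<Longrightarrow> g e \<in> F \<and> e \<in> g e"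
    by (auto dest!: bchoice)
  have "indep {e \<in> E. h (g e) = i}" for i
  proof (cases "\<exists>d\<in>E. h (g d) = i")
    case True
    then obtain d where d: "d \<in> E" "h (g d) = i" by blast
    have "g e = g d" if "e \<in> E" "h (g e) = i" for e
      using that d g[OF d(1)] g[OF that(1)] h by (metis bij_betw_def inj_onD)
    then have "{e \<in> E. h (g e) = i} \<subseteq> g d" using g by force
    then show ?thesis using indep_subset F(3) g d(1) by blast
  next
    case False
    then have "{e \<in> E. h (g e) = i} = {}" by auto
    then show ?thesis using indep_empty by (simp only:)
  qed
  moreover have "h (g e) < k" if "e \<in> E" for e
    using bij_betw_apply[OF h, of "g e"] g[OF that] assms(2) F(2) by simp
  ultimately show ?thesis
    unfolding partition_colouring_def by (intro exI[of _ "\<lambda>e. h (g e)"]) blast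
qed

section \<open>Recolouring two classes and maximal agreement\<close>

definition recolour :: "nat \<Rightarrow> nat \<Rightarrow> ('a \<Rightarrow> bool) \<Rightarrow> ('a \<Rightarrow> nat) \<Rightarrow> 'a \<Rightarrow> nat" where
  "recolour i j c f e = (if f e = i \<or> f e = j then (if c e then i else j) else f e)"

text \<open>The new classes \<open>i\<close> and \<open>j\<close> are the two colour classes of
  \<open>c\<close> on the union of the old ones. Since \<open>c\<close> separates matched elements,
  neither contains a matched pair, so \<open>ind\<close> applies to both.\<close>

lemma (in matroid) partition_colouring_recolour:
  assumes f: "partition_colouring E indep k f" and "i < k" "j < k" "i \<noteq> j"
    and ind: "\<And>C. C \<subseteq> {e \<in> E. f e = i} \<union> {e \<in> E. f e = j} \<Longrightarrow>
      \<forall>x\<in>X. x \<notin> C \<or> \<phi> x \<notin> C \<Longrightarrow> indep C"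
    and c: "\<forall>x\<in>X. c x \<noteq> c (\<phi> x)"
  shows "partition_colouring E indep k (recolour i j c f)"
proof -
  have "indep {e \<in> E. recolour i j c f e = l}" for l
  proof (cases "l = i \<or> l = j")
    case True
    have "{e \<in> E. recolour i j c f e = l} =
        {e \<in> E. (f e = i \<or> f e = j) \<and> c e = (l = i)}"
      using True \<open>i \<noteq> j\<close> by (auto simp: recolour_def split: if_splits)
    moreover have "indep {e \<in> E. (f e = i \<or> f e = j) \<and> c e = (l = i)}"
      by (rule ind) (use c in auto)
    ultimately show ?thesis by simp
  next
    case False
    then have "{e \<in> E. recolour i j c f e = l} = {e \<in> E. f e = l}"
      by (auto simp: recolour_def)
    then show ?thesis using f by (simp add: partition_colouring_def)
  qed
  then show ?thesis
    using f assms(2,3) by (auto simp: partition_colouring_def recolour_def)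
qed

lemma common_partition_colouring:
  assumes M1: "matroid E indep1" and M2: "matroid E indep2"
    and r1: "strongly_base_reorderable indep1" and r2: "strongly_base_reorderable indep2"
    and ex1: "\<exists>a. partition_colouring E indep1 k a" and ex2: "\<exists>b. partition_colouring E indep2 k b"
  shows "\<exists>f. partition_colouring E (\<lambda>X. indep1 X \<and> indep2 X) k f"
proof -
  interpret M1: matroid E indep1 by fact
  interpret M2: matroid E indep2 by fact
  define Q where
    "Q = (\<lambda>(a, b). partition_colouring E indep1 k a \<and> partition_colouring E indep2 k b)"
  define agr :: "('a \<Rightarrow> nat) \<times> ('a \<Rightarrow> nat) \<Rightarrow> nat" where
    "agr = (\<lambda>(a, b). card {e \<in> E. a e = b e})"
  obtain p where "Q p" using ex1 ex2 by (auto simp: Q_def)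
  moreover have "agr q \<le> card E" for q
    by (auto simp: agr_def split: prod.split intro: card_mono M1.finite_ground)
  ultimately obtain a b where "Q (a, b)" and agr_max: "\<And>q. Q q \<Longrightarrow> agr q \<le> agr (a, b)"
    using ex_has_greatest_nat[of Q p agr "Suc (card E)"] by (metis le_imp_less_Suc surj_pair)
  then have a: "partition_colouring E indep1 k a" and b: "partition_colouring E indep2 k b"
    by (auto simp: Q_def)
  have agree: "a e = b e" if "e \<in> E" for e
  proof (rule ccontr)
    assume ne: "a e \<noteq> b e"
    let ?i = "a e" and ?j = "b e"
    have ij: "?i < k" "?j < k" using a b that by (auto simp: partition_colouring_def)
    have ind1: "indep1 {d \<in> E. a d = l}" and ind2: "indep2 {d \<in> E. b d = l}" for l
      using a b by (auto simp: partition_colouring_def)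
    obtain X Y \<phi> where X: "finite X" "bij_betw \<phi> X Y" "X \<inter> Y = {}"
      "\<And>C. C \<subseteq> {d \<in> E. a d = ?i} \<union> {d \<in> E. a d = ?j} \<Longrightarrow>
        \<forall>x\<in>X. x \<notin> C \<or> \<phi> x \<notin> C \<Longrightarrow> indep1 C"
      by (rule M1.exchange_matching[OF r1 ind1[of ?i] ind1[of ?j]]) (rule that)
    obtain Z W \<psi> where Z: "finite Z" "bij_betw \<psi> Z W" "Z \<inter> W = {}"
      "\<And>C. C \<subseteq> {d \<in> E. b d = ?i} \<union> {d \<in> E. b d = ?j} \<Longrightarrow>
        \<forall>x\<in>Z. x \<notin> C \<or> \<psi> x \<notin> C \<Longrightarrow> indep2 C"
      by (rule M2.exchange_matching[OF r2 ind2[of ?i] ind2[of ?j]]) (rule that)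
    obtain c :: "'a \<Rightarrow> bool" where c: "\<forall>x\<in>X. c x \<noteq> c (\<phi> x)" "\<forall>z\<in>Z. c z \<noteq> c (\<psi> z)"
      using two_bijections_colouring[OF X(1-3) Z(2,3)] by blast
    let ?a = "recolour ?i ?j c a" and ?b = "recolour ?i ?j c b"
    have "Q (?a, ?b)"
      using M1.partition_colouring_recolour[OF a ij ne X(4) c(1)]
        M2.partition_colouring_recolour[OF b ij ne Z(4) c(2)] by (simp add: Q_def)
    then have "card {d \<in> E. ?a d = ?b d} \<le> card {d \<in> E. a d = b d}"
      using agr_max by (fastforce simp: agr_def)
    \<comment> \<open>Both partitions are recoloured with the same \<open>c\<close>, so equal
      indices stay equal. The element \<open>e\<close> is a new agreement: its indices
      \<open>?i\<close> and \<open>?j\<close> are both replaced by the one that \<open>c e\<close>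
      selects.\<close>
    moreover have "{d \<in> E. a d = b d} \<subset> {d \<in> E. ?a d = ?b d}"
    proof (rule psubsetI)
      show "{d \<in> E. a d = b d} \<subseteq> {d \<in> E. ?a d = ?b d}" by (auto simp: recolour_def)
      have "e \<in> {d \<in> E. ?a d = ?b d}" using that by (simp add: recolour_def)
      then show "{d \<in> E. a d = b d} \<noteq> {d \<in> E. ?a d = ?b d}" using ne by blast
    qed
    then have "card {d \<in> E. a d = b d} < card {d \<in> E. ?a d = ?b d}"
      by (intro psubset_card_mono) (auto simp: M1.finite_ground)
    ultimately show False by simp
  qed
  \<comment> \<open>Each class of \<open>a\<close> is also a class of \<open>b\<close>, hence
    independent in both matroids, and \<open>a\<close> is the witness.\<close>
  then have "{e \<in> E. a e = i} = {e \<in> E. b e = i}" for i by auto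
  then show ?thesis using a b by (auto simp: partition_colouring_def)
qed

lemma covering_number_antimono:
  assumes "finite E" "\<forall>e\<in>E. P {e}" "\<And>X. P X \<Longrightarrow> Q X"
  shows "covering_number E Q \<le> covering_number E P"
proof -
  obtain F where "finite F" "card F = covering_number E P" "\<forall>X\<in>F. P X" "E \<subseteq> \<Union>F"
    using covering_number_attained[OF assms(1,2)] by blast
  then show ?thesis
    unfolding covering_number_def[of E Q] using assms(3) by (intro Least_le) blast
qed

theorem theorem6:
  fixes E :: "'a set" and indep1 indep2 :: "'a set \<Rightarrow> bool"
  assumes "matroid E indep1" and "matroid E indep2"
    and "loopless E indep1" and "loopless E indep2"
    and "strongly_base_reorderable indep1" and "strongly_base_reorderable indep2"
  shows "covering_number E (\<lambda>X. indep1 X \<and> indep2 X) =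
    max (covering_number E indep1) (covering_number E indep2)"
proof (rule antisym)
  let ?k = "max (covering_number E indep1) (covering_number E indep2)"
  have fin: "finite E" using assms(1) by (rule matroid.finite_ground)
  have "\<exists>f. partition_colouring E (\<lambda>X. indep1 X \<and> indep2 X) ?k f"
    by (intro common_partition_colouring assms matroid.partition_colouring_exists) auto
  then show "covering_number E (\<lambda>X. indep1 X \<and> indep2 X) \<le> ?k"
    using covering_number_le fin by blast
  \<comment> \<open>Common independent singletons guarantee that a common cover exists, so the
    \<open>LEAST\<close> on the left is attained; such a cover also serves each matroid
    alone.\<close>
  have "\<forall>e\<in>E. indep1 {e} \<and> indep2 {e}"
    using assms(3,4) by (auto simp: loopless_def)
  then show "?k \<le> covering_number E (\<lambda>X. indep1 X \<and> indep2 X)"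
    by (auto intro!: covering_number_antimono fin)
qed

end
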